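(* Let $m,n\ge 3$ and $p\ge 1$ be integers with $p\le R(m,n)-1$, and let $\alpha,\beta,\gamma,\delta$ be integers with $\alpha\ge R(m-2,n)-1$, $\beta\ge R(m,n-2)-1$, $\gamma\ge R(m-1,n)-1$ and $\delta\ge R(m,n-1)-1$. Then $$(p-1)(p-2)\le \max_{d\in[p-1-\delta,\gamma]}\left( 2\binom{p-d-1}{2}+2\Delta(m,n,p,d)+3d(p-d-1)\right),$$ where $d$ ranges over integers and $$\Delta(m,n,p,d)=E(m-1,n;d)-e(m,n-1;p-d-1).$$ The maximum is taken over those integers $d\in[p-1-\delta,\gamma]$ for which both $E(m-1,n;d)$ and $e(m,n-1;p-d-1)$ are defined, that is, for which $0\le d\le p-1$, an $(m-1,n;d)$-graph exists and an $(m,n-1;p-d-1)$-graph exists.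
   Context: All graphs are finite, simple and undirected. For positive integers $m,n$, an $(m,n)$-graph is a graph containing no clique of size $m$ and no independent set of size $n$ (sizes count vertices). An $(m,n;p)$-graph is an $(m,n)$-graph of order $p$, i.e. with exactly $p$ vertices; the graph with $0$ vertices is allowed as an $(m,n;0)$-graph. The two-colour Ramsey number $R(m,n)$ is the least natural number $p$ such that there is no $(m,n;p)$-graph; in particular $R(1,n)=R(m,1)=1$. Whenever an $(m,n;p)$-graph exists, $e(m,n;p)$ and $E(m,n;p)$ denote respectively the minimum and the maximum number of edges in an $(m,n;p)$-graph. *)

theory Defs
  imports Complex_Main "HOL-Library.Ramsey"
begin

definition simple_graph :: "'a set \<Rightarrow> 'a set set \<Rightarrow> bool" where
  "simple_graph V E \<longleftrightarrow> finite V \<and> E \<subseteq> [V]\<^bsup>2\<^esup>"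

text \<open>The predicates \<open>clique\<close> and \<open>indep\<close> of \<open>HOL-Library.Ramsey\<close> make sense for
  arbitrary vertex sets, so the candidate set is restricted to subsets of \<open>V\<close>.\<close>

definition ramsey_graph :: "nat \<Rightarrow> nat \<Rightarrow> nat \<Rightarrow> 'a set \<Rightarrow> 'a set set \<Rightarrow> bool" where
  "ramsey_graph m n p V E \<longleftrightarrow>
     simple_graph V E \<and> card V = p \<and>
     \<not> (\<exists>K\<subseteq>V. card K = m \<and> clique K E) \<and>
     \<not> (\<exists>I\<subseteq>V. card I = n \<and> indep I E)"

text \<open>Every finite graph has an isomorphic copy with natural numbers as vertices, so
  existence and edge counts below are taken over graphs on \<open>nat\<close>.\<close>

definition ramsey_graph_exists :: "nat \<Rightarrow> nat \<Rightarrow> nat \<Rightarrow> bool" where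
  "ramsey_graph_exists m n p \<longleftrightarrow> (\<exists>(V :: nat set) E. ramsey_graph m n p V E)"

definition ramsey_number :: "nat \<Rightarrow> nat \<Rightarrow> nat" where
  "ramsey_number m n = (LEAST p. \<not> ramsey_graph_exists m n p)"

definition edge_counts :: "nat \<Rightarrow> nat \<Rightarrow> nat \<Rightarrow> nat set" where
  "edge_counts m n p = {card E | (V :: nat set) E. ramsey_graph m n p V E}"

text \<open>The next two values, and hence the difference \<open>Delta\<close>, are meaningful only where
  the graphs involved exist. The sets of edge counts are bounded by \<open>p choose 2\<close>.\<close>

definition min_edges :: "nat \<Rightarrow> nat \<Rightarrow> nat \<Rightarrow> nat" where
  "min_edges m n p = Min (edge_counts m n p)"

definition max_edges :: "nat \<Rightarrow> nat \<Rightarrow> nat \<Rightarrow> nat" where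
  "max_edges m n p = Max (edge_counts m n p)"

definition Delta :: "nat \<Rightarrow> nat \<Rightarrow> nat \<Rightarrow> nat \<Rightarrow> int" where
  "Delta m n p d = int (max_edges (m - 1) n d) - int (min_edges m (n - 1) (p - d - 1))"

end

theory Submission
  imports Defs
begin

text \<open>Sum the expression under the maximum, with \<open>E\<close> and \<open>e\<close> replaced by the actual edge numbers
  of the subgraphs induced on the neighbours and on the non-neighbours of a vertex of degree \<open>d\<close>,
  over all vertices of an \<open>(m,n;p)\<close>-graph. By Goodman's count of triangles and independent
  triples, every ordered triple of distinct vertices contributes exactly 1 on average, so the sum is
  \<open>p(p-1)(p-2)\<close> and some vertex reaches the average \<open>(p-1)(p-2)\<close>.\<close>

section \<open>Induced subgraphs of Ramsey graphs\<close>

text \<open>On pairs inside \<open>W\<close> the restricted edge set agrees with \<open>E\<close>,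
  so the hypotheses can speak of \<open>E\<close> itself. The sizes \<open>k\<close> and
  \<open>l\<close> are independent of \<open>m\<close> and \<open>n\<close>, which lets one
  statement serve neighbours, non-neighbours and arbitrary vertex subsets.\<close>

lemma ramsey_graph_induced:
  assumes "ramsey_graph m n p V E" and "W \<subseteq> V"
    and "\<And>K. K \<subseteq> W \<Longrightarrow> card K = k \<Longrightarrow> clique K E \<Longrightarrow> False"
    and "\<And>I. I \<subseteq> W \<Longrightarrow> card I = l \<Longrightarrow> indep I E \<Longrightarrow> False"
  shows "ramsey_graph k l (card W) W (E \<inter> [W]\<^bsup>2\<^esup>)"
proof -
  have "finite W"
    using assms(1,2) by (auto simp: ramsey_graph_def simple_graph_def intro: finite_subset)
  moreover have "clique K E" if "clique K (E \<inter> [W]\<^bsup>2\<^esup>)" for K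
    using that by (auto simp: clique_def)
  moreover have "indep I E" if "I \<subseteq> W" "indep I (E \<inter> [W]\<^bsup>2\<^esup>)" for I
    using that by (auto simp: indep_def subset_iff)
  ultimately show ?thesis
    using assms(3,4) unfolding ramsey_graph_def simple_graph_def by auto
qed

text \<open>A clique of size \<open>m\<close> among neighbours of \<open>v\<close> would grow to
  size \<open>Suc m\<close> by adjoining \<open>v\<close>.\<close>

lemma ramsey_graph_neighbours:
  assumes "ramsey_graph (Suc m) n p V E" and "v \<in> V" and "W \<subseteq> V"
    and W: "\<And>x. x \<in> W \<Longrightarrow> x \<noteq> v \<and> {v, x} \<in> E"
  shows "ramsey_graph m n (card W) W (E \<inter> [W]\<^bsup>2\<^esup>)"
proof (rule ramsey_graph_induced[OF assms(1,3)])
  fix K assume K: "K \<subseteq> W" "card K = m" "clique K E"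
  have "finite V"
    using assms(1) by (simp add: ramsey_graph_def simple_graph_def)
  then have "finite K"
    using K(1) assms(3) by (meson finite_subset)
  moreover have "v \<notin> K"
    using K(1) W by auto
  ultimately have "card (insert v K) = Suc m"
    using K(2) by simp
  moreover have "clique (insert v K) E"
    using K(1,3) W by (force simp: clique_def insert_commute)
  moreover have "insert v K \<subseteq> V"
    using assms(2,3) K(1) by auto
  ultimately show False
    using assms(1) unfolding ramsey_graph_def by blast
next
  fix I assume "I \<subseteq> W" "card I = n" "indep I E"
  then show False
    using assms(1,3) unfolding ramsey_graph_def by blast
qed

text \<open>Dual argument: \<open>v\<close> extends any independent set among its
  non-neighbours.\<close>

lemma ramsey_graph_non_neighbours:
  assumes "ramsey_graph m (Suc n) p V E" and "v \<in> V" and "W \<subseteq> V"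
    and W: "\<And>x. x \<in> W \<Longrightarrow> x \<noteq> v \<and> {v, x} \<notin> E"
  shows "ramsey_graph m n (card W) W (E \<inter> [W]\<^bsup>2\<^esup>)"
proof (rule ramsey_graph_induced[OF assms(1,3)])
  fix I assume I: "I \<subseteq> W" "card I = n" "indep I E"
  have "finite V"
    using assms(1) by (simp add: ramsey_graph_def simple_graph_def)
  then have "finite I"
    using I(1) assms(3) by (meson finite_subset)
  moreover have "v \<notin> I"
    using I(1) W by auto
  ultimately have "card (insert v I) = Suc n"
    using I(2) by simp
  moreover have "indep (insert v I) E"
    using I(1,3) W by (force simp: indep_def insert_commute)
  moreover have "insert v I \<subseteq> V"
    using assms(2,3) I(1) by auto
  ultimately show False
    using assms(1) unfolding ramsey_graph_def by blast
next
  fix K assume "K \<subseteq> W" "card K = m" "clique K E"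
  then show False
    using assms(1,3) unfolding ramsey_graph_def by blast
qed

section \<open>Existence of Ramsey graphs and the Ramsey number\<close>

text \<open>Deleting vertices creates neither cliques nor independent sets, so the orders that occur
  form an initial segment.\<close>

lemma ramsey_graph_exists_mono:
  assumes "ramsey_graph_exists m n p" and "q \<le> p"
  shows "ramsey_graph_exists m n q"
proof -
  obtain V :: "nat set" and E where G: "ramsey_graph m n p V E"
    using assms(1) by (auto simp: ramsey_graph_exists_def)
  then obtain W where W: "W \<subseteq> V" "card W = q"
    using assms(2) obtain_subset_with_card_n[of q V] by (auto simp: ramsey_graph_def)
  have "ramsey_graph m n (card W) W (E \<inter> [W]\<^bsup>2\<^esup>)"
    by (rule ramsey_graph_induced[OF G W(1)])
      (use G W(1) in \<open>auto simp: ramsey_graph_def dest: order_trans\<close>)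
  then show ?thesis
    using W(2) unfolding ramsey_graph_exists_def by blast
qed

text \<open>Ramsey's theorem provides some order without a graph; this is what makes the
  \<open>LEAST\<close> in \<open>ramsey_number\<close> meaningful.\<close>

lemma not_ramsey_graph_exists_ramsey_number:
  "\<not> ramsey_graph_exists m n (ramsey_number m n)"
proof -
  obtain r where r: "\<And>(V :: nat set) E. finite V \<Longrightarrow> r \<le> card V \<Longrightarrow>
      \<exists>R\<subseteq>V. card R = m \<and> clique R E \<or> card R = n \<and> indep R E"
    using ramsey2[of m n] by meson
  have "\<not> ramsey_graph_exists m n r"
  proof
    assume "ramsey_graph_exists m n r"
    then obtain V :: "nat set" and E where G: "ramsey_graph m n r V E"
      by (auto simp: ramsey_graph_exists_def)
    then have "finite V" "r \<le> card V"
      by (auto simp: ramsey_graph_def simple_graph_def)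
    from r[OF this, of E] G show False
      unfolding ramsey_graph_def by blast
  qed
  then show ?thesis
    unfolding ramsey_number_def by (rule LeastI)
qed

lemma ramsey_graph_exists_iff: "ramsey_graph_exists m n p \<longleftrightarrow> p < ramsey_number m n"
proof
  assume "ramsey_graph_exists m n p"
  then show "p < ramsey_number m n"
    using ramsey_graph_exists_mono not_ramsey_graph_exists_ramsey_number by (meson not_less)
next
  assume "p < ramsey_number m n"
  then show "ramsey_graph_exists m n p"
    unfolding ramsey_number_def using not_less_Least by blast
qed

section \<open>Edge counts\<close>

text \<open>Finiteness is what lets \<open>Min\<close> and \<open>Max\<close> bound the edge number
  of a concrete graph.\<close>

lemma finite_edge_counts: "finite (edge_counts m n p)"
proof (rule finite_subset)
  show "edge_counts m n p \<subseteq> {..p choose 2}"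
  proof
    fix c assume "c \<in> edge_counts m n p"
    then obtain V :: "nat set" and E where "c = card E" and G: "ramsey_graph m n p V E"
      by (auto simp: edge_counts_def)
    moreover have "card E \<le> card ([V]\<^bsup>2\<^esup>)"
      using G by (intro card_mono finite_imp_finite_nsets)
        (auto simp: ramsey_graph_def simple_graph_def)
    ultimately show "c \<in> {..p choose 2}"
      using G by (simp add: ramsey_graph_def)
  qed
qed simp

lemma
  fixes V :: "nat set"
  assumes "ramsey_graph m n p V E"
  shows min_edges_le: "min_edges m n p \<le> card E" and max_edges_ge: "card E \<le> max_edges m n p"
proof -
  have "card E \<in> edge_counts m n p"
    using assms by (auto simp: edge_counts_def)
  then show "min_edges m n p \<le> card E" "card E \<le> max_edges m n p"
    by (simp_all add: min_edges_def max_edges_def finite_edge_counts)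
qed

text \<open>Each edge is met by two ordered pairs, and the diagonal adds nothing because an edge has
  two distinct ends.\<close>

lemma sum_of_bool_edges:
  assumes "finite V" and "E \<subseteq> [V]\<^bsup>2\<^esup>"
  shows "(\<Sum>x\<in>V. \<Sum>y\<in>V. of_bool ({x, y} \<in> E)) = 2 * int (card E)"
proof -
  have "finite E"
    using assms finite_imp_finite_nsets finite_subset by blast
  \<comment> \<open>Membership is written as a sum over all edges, so that the order of summation
    can be exchanged and each edge treated separately.\<close>
  have "(\<Sum>x\<in>V. \<Sum>y\<in>V. of_bool ({x, y} \<in> E)) =
      (\<Sum>x\<in>V. \<Sum>y\<in>V. \<Sum>e\<in>E. of_bool (e = {x, y}) :: int)"
    using \<open>finite E\<close> by (simp add: of_bool_def)
  also have "\<dots> = (\<Sum>x\<in>V. \<Sum>e\<in>E. \<Sum>y\<in>V. of_bool (e = {x, y}))"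
    by (intro sum.cong refl sum.swap)
  also have "\<dots> = (\<Sum>e\<in>E. \<Sum>x\<in>V. \<Sum>y\<in>V. of_bool (e = {x, y}))"
    by (rule sum.swap)
  also have "\<dots> = (\<Sum>e\<in>E. 2)"
  proof (rule sum.cong[OF refl])
    fix e assume "e \<in> E"
    then obtain a b where e: "e = {a, b}" "a \<noteq> b" "a \<in> V" "b \<in> V"
      using assms(2) by (auto elim!: nsets2_E)
    have "(\<Sum>x\<in>V. \<Sum>y\<in>V. of_bool (e = {x, y})) =
        (\<Sum>(x, y)\<in>V \<times> V. of_bool (e = {x, y}) :: int)"
      by (simp add: sum.cartesian_product)
    also have "\<dots> = (\<Sum>(x, y)\<in>{(a, b), (b, a)}. of_bool (e = {x, y}))"
      by (rule sum.mono_neutral_right) (use assms(1) e in \<open>auto simp: doubleton_eq_iff\<close>)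
    also have "\<dots> = 2"
      using e by (simp add: insert_commute)
    finally show "(\<Sum>x\<in>V. \<Sum>y\<in>V. of_bool (e = {x, y})) = (2 :: int)" .
  qed
  finally show ?thesis
    by simp
qed

lemma two_times_choose_two: "2 * int (k choose 2) = int k * (int k - 1)"
  by (induction k) (simp_all add: numeral_2_eq_2 algebra_simps)

section \<open>The weight of a vertex as a count of triples\<close>

definition neighbours :: "'a set \<Rightarrow> 'a set set \<Rightarrow> 'a \<Rightarrow> 'a set" where
  "neighbours V E v = {x \<in> V. {v, x} \<in> E}"

definition non_neighbours :: "'a set \<Rightarrow> 'a set set \<Rightarrow> 'a \<Rightarrow> 'a set" where
  "non_neighbours V E v = {x \<in> V. x \<noteq> v \<and> {v, x} \<notin> E}"

definition goodman_weight :: "'a set \<Rightarrow> 'a set set \<Rightarrow> 'a \<Rightarrow> int" where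
  "goodman_weight V E v =
    (let N = neighbours V E v; M = non_neighbours V E v in
      2 * int (card M choose 2) + 2 * (int (card (E \<inter> [N]\<^bsup>2\<^esup>)) - int (card (E \<inter> [M]\<^bsup>2\<^esup>)))
      + 3 * int (card N) * int (card M))"

lemma simple_graph_no_loop: "simple_graph V E \<Longrightarrow> {x} \<notin> E"
  by (auto simp: simple_graph_def nsets_def)

lemma card_neighbours:
  assumes "simple_graph V E" and "v \<in> V"
  shows "card V = card (neighbours V E v) + card (non_neighbours V E v) + 1"
proof -
  have "finite V"
    using assms by (simp add: simple_graph_def)
  have "V = insert v (neighbours V E v \<union> non_neighbours V E v)"
    using assms(2) by (auto simp: neighbours_def non_neighbours_def)
  then have "card V = card (insert v (neighbours V E v \<union> non_neighbours V E v))"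
    by simp
  also have "\<dots> = card (neighbours V E v \<union> non_neighbours V E v) + 1"
    using \<open>finite V\<close> simple_graph_no_loop[OF assms(1), of v]
    by (subst card_insert_disjoint) (auto simp: neighbours_def non_neighbours_def)
  also have "card (neighbours V E v \<union> non_neighbours V E v) =
      card (neighbours V E v) + card (non_neighbours V E v)"
    using \<open>finite V\<close> by (intro card_Un_disjoint) (auto simp: neighbours_def non_neighbours_def)
  finally show ?thesis .
qed

text \<open>Sums over neighbours and non-neighbours acquire the common range \<open>V\<close>, so
  that they can be combined term by term.\<close>

lemma double_sum_filter:
  fixes f :: "'a \<Rightarrow> 'a \<Rightarrow> int"
  assumes "finite V"
  shows "(\<Sum>x\<in>{x \<in> V. P x}. \<Sum>y\<in>{y \<in> V. Q y}. f x y) =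
    (\<Sum>x\<in>V. \<Sum>y\<in>V. of_bool (P x) * of_bool (Q y) * f x y)"
proof -
  have "(\<Sum>x\<in>{x \<in> V. P x}. \<Sum>y\<in>{y \<in> V. Q y}. f x y) =
      (\<Sum>x\<in>V. if P x then \<Sum>y\<in>V. if Q y then f x y else 0 else 0)"
    using assms by (simp add: sum.inter_filter)
  also have "\<dots> = (\<Sum>x\<in>V. \<Sum>y\<in>V. of_bool (P x) * of_bool (Q y) * f x y)"
    by (rule sum.cong[OF refl]) (auto intro!: sum.cong)
  finally show ?thesis .
qed

text \<open>The three terms detect triangles through \<open>v\<close>, independent triples through
  \<open>v\<close>, and pairs of a neighbour \<open>x\<close> with a non-neighbour \<open>y\<close>.
  Subtracting twice the edges inside the non-neighbours from twice the number of pairs there leaves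
  the ordered non-adjacent pairs, which give the second term.\<close>

lemma goodman_weight_eq_sum:
  assumes "simple_graph V E"
  defines "a \<equiv> \<lambda>x y. of_bool ({x, y} \<in> E) :: int"
  shows "goodman_weight V E v = (\<Sum>x\<in>V. \<Sum>y\<in>V. of_bool (v \<noteq> x \<and> v \<noteq> y \<and> x \<noteq> y) *
    (a v x * a v y * a x y + (1 - a v x) * (1 - a v y) * (1 - a x y) + 3 * a v x * (1 - a v y)))"
proof -
  define N M where "N = neighbours V E v" and "M = non_neighbours V E v"
  have [simp]: "finite V" "{x} \<notin> E" for x
    using assms(1) simple_graph_no_loop[OF assms(1)] by (simp_all add: simple_graph_def)
  have fin [simp]: "finite N" "finite M"
    by (simp_all add: N_def M_def neighbours_def non_neighbours_def)
  have edges: "2 * int (card (E \<inter> [W]\<^bsup>2\<^esup>)) = (\<Sum>x\<in>W. \<Sum>y\<in>W. a x y)" if "finite W" for W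
  proof -
    have "(\<Sum>x\<in>W. \<Sum>y\<in>W. a x y) = (\<Sum>x\<in>W. \<Sum>y\<in>W. of_bool ({x, y} \<in> E \<inter> [W]\<^bsup>2\<^esup>))"
      unfolding a_def by (intro sum.cong refl arg_cong[where f = of_bool]) auto
    then show ?thesis
      using sum_of_bool_edges[of W "E \<inter> [W]\<^bsup>2\<^esup>"] that by simp
  qed
  have pairs: "2 * int (card M choose 2) = (\<Sum>x\<in>M. \<Sum>y\<in>M. of_bool (x \<noteq> y))"
  proof -
    have "(\<Sum>x\<in>M. \<Sum>y\<in>M. of_bool (x \<noteq> y)) = (\<Sum>x\<in>M. \<Sum>y\<in>M. 1 - of_bool (x = y) :: int)"
      by (intro sum.cong refl) auto
    also have "\<dots> = int (card M) * (int (card M) - 1)"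
      by (simp add: sum_subtractf of_bool_def right_diff_distrib)
    finally show ?thesis
      by (simp add: two_times_choose_two)
  qed
  have mixed: "int (card N) * int (card M) = (\<Sum>x\<in>N. \<Sum>y\<in>M. 1)"
    by simp
  have "goodman_weight V E v = 2 * int (card M choose 2) + 2 * int (card (E \<inter> [N]\<^bsup>2\<^esup>))
      - 2 * int (card (E \<inter> [M]\<^bsup>2\<^esup>)) + 3 * (int (card N) * int (card M))"
    by (simp add: goodman_weight_def Let_def N_def M_def algebra_simps)
  also have "\<dots> = (\<Sum>x\<in>M. \<Sum>y\<in>M. of_bool (x \<noteq> y)) + (\<Sum>x\<in>N. \<Sum>y\<in>N. a x y)
      - (\<Sum>x\<in>M. \<Sum>y\<in>M. a x y) + 3 * (\<Sum>x\<in>N. \<Sum>y\<in>M. 1)"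
    unfolding edges[OF fin(1)] edges[OF fin(2)] pairs mixed ..
  also have "\<dots> = (\<Sum>x\<in>V. \<Sum>y\<in>V. of_bool (v \<noteq> x \<and> v \<noteq> y \<and> x \<noteq> y) *
    (a v x * a v y * a x y + (1 - a v x) * (1 - a v y) * (1 - a x y) + 3 * a v x * (1 - a v y)))"
    unfolding N_def M_def neighbours_def non_neighbours_def double_sum_filter[OF \<open>finite V\<close>]
      sum_distrib_left sum.distrib[symmetric] sum_subtractf[symmetric]
    by (intro sum.cong refl) (auto simp: a_def of_bool_def insert_commute)
  finally show ?thesis .
qed

section \<open>Summation over all vertices\<close>

text \<open>A sum over ordered triples of distinct vertices does not change when the roles of the
  three vertices are permuted. Up to such permutations the summand of the weight is the constant 1,
  so the total is the number of these triples.\<close>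

lemma sum_goodman_weight:
  assumes "simple_graph V E"
  shows "(\<Sum>v\<in>V. goodman_weight V E v) =
    int (card V) * (int (card V) - 1) * (int (card V) - 2)"
proof -
  define a where "a x y = (of_bool ({x, y} \<in> E) :: int)" for x y
  define T where "T f = (\<Sum>v\<in>V. \<Sum>x\<in>V. \<Sum>y\<in>V.
    of_bool (v \<noteq> x \<and> v \<noteq> y \<and> x \<noteq> y) * (f v x y :: int))" for f
  have "finite V"
    using assms by (simp add: simple_graph_def)
  have a_commute: "a x y = a y x" for x y
    by (simp add: a_def insert_commute)
  have T_add: "T (\<lambda>v x y. f v x y + g v x y) = T f + T g" for f g
    by (simp add: T_def distrib_left sum.distrib)
  have T_diff: "T (\<lambda>v x y. f v x y - g v x y) = T f - T g" for f g
    by (simp add: T_def right_diff_distrib sum_subtractf)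
  \<comment> \<open>The two transpositions \<open>T12\<close> and \<open>T23\<close> generate all
    permutations of the three positions.\<close>
  have T12: "T (\<lambda>v x y. f x v y) = T f" for f
    unfolding T_def by (subst sum.swap) (auto intro!: sum.cong)
  have T23: "T (\<lambda>v x y. f v y x) = T f" for f
    unfolding T_def by (rule sum.cong[OF refl], subst sum.swap) (auto intro!: sum.cong)
  have single: "T (\<lambda>v x y. a v y) = T (\<lambda>v x y. a v x)" "T (\<lambda>v x y. a x y) = T (\<lambda>v x y. a v x)"
    using T23[of "\<lambda>v x y. a v x"] T12[of "\<lambda>v x y. a v y"] by simp_all
  have double: "T (\<lambda>v x y. a v x * a x y) = T (\<lambda>v x y. a v x * a v y)"
      "T (\<lambda>v x y. a v y * a x y) = T (\<lambda>v x y. a v x * a v y)"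
  proof -
    show *: "T (\<lambda>v x y. a v x * a x y) = T (\<lambda>v x y. a v x * a v y)"
      using T12[of "\<lambda>v x y. a v x * a v y"] by (simp add: a_commute)
    show "T (\<lambda>v x y. a v y * a x y) = T (\<lambda>v x y. a v x * a v y)"
      using T23[of "\<lambda>v x y. a v x * a x y"] * by (simp add: a_commute)
  qed
  have "(\<Sum>v\<in>V. goodman_weight V E v) = T (\<lambda>v x y. a v x * a v y * a x y +
      (1 - a v x) * (1 - a v y) * (1 - a x y) + 3 * a v x * (1 - a v y))"
    unfolding T_def a_def goodman_weight_eq_sum[OF assms] ..
  \<comment> \<open>The cubic terms cancel on expansion. The rest is grouped into differences of
    monomials that are equal up to renaming the vertices, so \<open>T\<close> sends each bracket to
    0.\<close>
  also have "\<dots> = T (\<lambda>v x y. 1 + (a v x - a v y) + (a v x - a x y)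
      + (a v x * a x y - a v x * a v y) + (a v y * a x y - a v x * a v y))"
    by (intro arg_cong[where f = T] ext) (simp add: algebra_simps)
  also have "\<dots> = T (\<lambda>v x y. 1)"
    unfolding T_add T_diff single double by simp
  also have "\<dots> = (\<Sum>v\<in>V. \<Sum>x\<in>V - {v}. int (card V) - 2)"
    unfolding T_def
  proof (rule sum.cong[OF refl])
    fix v assume "v \<in> V"
    have inner: "(\<Sum>y\<in>V. of_bool (v \<noteq> x \<and> v \<noteq> y \<and> x \<noteq> y) * (1 :: int)) =
        (if x = v then 0 else int (card V) - 2)" if "x \<in> V" for x
    proof -
      \<comment> \<open>When \<open>v\<close> and \<open>x\<close> differ, \<open>y\<close> cannot
        equal both, so the indicator becomes linear in the two equalities.\<close>
      have "(\<Sum>y\<in>V. of_bool (v \<noteq> x \<and> v \<noteq> y \<and> x \<noteq> y) * (1 :: int)) =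
          (\<Sum>y\<in>V. of_bool (v \<noteq> x) * (1 - of_bool (v = y) - of_bool (x = y)))"
        by (intro sum.cong refl) auto
      also have "\<dots> = of_bool (v \<noteq> x) * (int (card V) - 2)"
        using \<open>finite V\<close> \<open>v \<in> V\<close> that
        by (simp add: sum_subtractf of_bool_def flip: sum_distrib_left)
      finally show ?thesis
        by simp
    qed
    have "(\<Sum>x\<in>V. \<Sum>y\<in>V. of_bool (v \<noteq> x \<and> v \<noteq> y \<and> x \<noteq> y) * (1 :: int)) =
        (\<Sum>x\<in>V. if x = v then 0 else int (card V) - 2)"
      by (rule sum.cong[OF refl inner])
    also have "\<dots> = (\<Sum>x\<in>V - {v}. int (card V) - 2)"
      using \<open>finite V\<close> by (intro sum.mono_neutral_cong_right) auto
    finally show "(\<Sum>x\<in>V. \<Sum>y\<in>V. of_bool (v \<noteq> x \<and> v \<noteq> y \<and> x \<noteq> y) * (1 :: int)) =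
        (\<Sum>x\<in>V - {v}. int (card V) - 2)" .
  qed
  also have "\<dots> = int (card V) * (int (card V) - 1) * (int (card V) - 2)"
  \<comment> \<open>For nonempty \<open>V\<close> the natural number \<open>card V - 1\<close> is a
    true difference; for empty \<open>V\<close> both sides are 0.\<close>
  proof (cases "V = {}")
    case False
    then have "card V \<ge> 1"
      using \<open>finite V\<close> by (simp add: Suc_le_eq card_gt_0_iff)
    then show ?thesis
      using \<open>finite V\<close> by (simp add: of_nat_diff algebra_simps)
  qed simp
  finally show ?thesis .
qed

section \<open>A vertex of at least average weight\<close>

theorem theorem1:
  fixes m n p :: nat and \<alpha> \<beta> \<gamma> \<delta> :: int and S :: "nat set"
  assumes "m \<ge> 3" and "n \<ge> 3" and "p \<ge> 1"
    and "int p \<le> int (ramsey_number m n) - 1"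
    and "\<alpha> \<ge> int (ramsey_number (m - 2) n) - 1"
    and "\<beta> \<ge> int (ramsey_number m (n - 2)) - 1"
    and "\<gamma> \<ge> int (ramsey_number (m - 1) n) - 1"
    and "\<delta> \<ge> int (ramsey_number m (n - 1)) - 1"
  defines "S \<equiv> {d. int p - 1 - \<delta> \<le> int d \<and> int d \<le> \<gamma> \<and> d \<le> p - 1
                  \<and> ramsey_graph_exists (m - 1) n d
                  \<and> ramsey_graph_exists m (n - 1) (p - d - 1)}"
  shows "S \<noteq> {} \<and>
    (int p - 1) * (int p - 2) \<le>
      Max ((\<lambda>d. 2 * int ((p - d - 1) choose 2) + 2 * Delta m n p d
                 + 3 * int d * int (p - d - 1)) ` S)"
proof -
  define f where "f d = 2 * int ((p - d - 1) choose 2) + 2 * Delta m n p d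
    + 3 * int d * int (p - d - 1)" for d
  have "ramsey_graph_exists m n p"
    using assms(4) by (simp add: ramsey_graph_exists_iff)
  then obtain V :: "nat set" and E where G: "ramsey_graph m n p V E"
    by (auto simp: ramsey_graph_exists_def)
  then have simple: "simple_graph V E" and card_V: "card V = p"
    by (auto simp: ramsey_graph_def)
  have "finite V"
    using simple by (simp add: simple_graph_def)
  have "\<exists>v\<in>V. (int p - 1) * (int p - 2) \<le> goodman_weight V E v"
  proof (rule ccontr)
    assume "\<not> ?thesis"
    \<comment> \<open>Strictness needs a vertex, which \<open>p \<ge> 1\<close> supplies.\<close>
    then have "(\<Sum>v\<in>V. goodman_weight V E v) < (\<Sum>v\<in>V. (int p - 1) * (int p - 2))"
      using \<open>finite V\<close> card_V \<open>p \<ge> 1\<close> by (intro sum_strict_mono) auto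
    then show False
      using sum_goodman_weight[OF simple] card_V by simp
  qed
  then obtain v where v: "v \<in> V" "(int p - 1) * (int p - 2) \<le> goodman_weight V E v"
    by blast
  define N M where "N = neighbours V E v" and "M = non_neighbours V E v"
  have p: "p = card N + card M + 1"
    using card_neighbours[OF simple v(1)] card_V by (simp add: N_def M_def)
  then have M: "p - card N - 1 = card M"
    by simp
  have GN: "ramsey_graph (m - 1) n (card N) N (E \<inter> [N]\<^bsup>2\<^esup>)"
    \<comment> \<open>Here \<open>Suc (m - 1)\<close> is \<open>m\<close> since \<open>m\<close> is
      positive, and the absence of loops keeps \<open>v\<close> out of \<open>N\<close>.\<close>
    by (rule ramsey_graph_neighbours[of "m - 1" n p V E v])
      (use G v(1) \<open>m \<ge> 3\<close> simple_graph_no_loop[OF simple] in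
        \<open>auto simp: N_def neighbours_def\<close>)
  have GM: "ramsey_graph m (n - 1) (card M) M (E \<inter> [M]\<^bsup>2\<^esup>)"
    by (rule ramsey_graph_non_neighbours[of m "n - 1" p V E v])
      (use G v(1) \<open>n \<ge> 3\<close> in \<open>auto simp: M_def non_neighbours_def\<close>)
  have ex: "ramsey_graph_exists (m - 1) n (card N)" "ramsey_graph_exists m (n - 1) (card M)"
    using GN GM by (auto simp: ramsey_graph_exists_def)
  \<comment> \<open>Existence puts \<open>card N\<close> and \<open>card M\<close> below the
    respective Ramsey numbers, hence at most \<gamma> and \<delta>. The bound on
    \<open>card M = p - 1 - card N\<close> is the lower end of the interval.\<close>
  then have "card N \<in> S"
    using assms(7,8) p unfolding S_def mem_Collect_eq M by (auto simp: ramsey_graph_exists_iff)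
  moreover have "finite S"
    by (rule finite_subset[of _ "{..p - 1}"]) (auto simp: S_def)
  \<comment> \<open>The edge number inside \<open>N\<close> enters positively and is at most the
    maximum; that inside \<open>M\<close> enters negatively and is at least the minimum.\<close>
  moreover have "goodman_weight V E v \<le> f (card N)"
    using max_edges_ge[OF GN] min_edges_le[OF GM] unfolding f_def Delta_def M
    by (simp add: goodman_weight_def Let_def flip: N_def M_def)
  ultimately have "S \<noteq> {}" "(int p - 1) * (int p - 2) \<le> f (card N)"
      "f (card N) \<le> Max (f ` S)"
    using v(2) by auto
  then have "S \<noteq> {} \<and> (int p - 1) * (int p - 2) \<le> Max (f ` S)"
    by linarith
  then show ?thesis
    unfolding f_def .
qed

end
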